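(* Let $N\ge 3$ be an integer, $\alpha=\pi/N$, and $d\in\mathbb{R}$ with $|d|<1$. For $t\in\mathbb{R}$ let $P=P(d,t)$ be the harmonic $N$-gon with consecutive vertices $w_1,\dots,w_N$ constructed in the context, let $\theta_k$ be the internal angle of $P$ at $w_k$, and let $\lambda=(\cot\theta_1,\cot\theta_2,\dots,\cot\theta_N)$. Then the elementary symmetric functions $e_1(\lambda),e_2(\lambda),\dots,e_{N-1}(\lambda)$ are invariant over the family, that is, they do not depend on $t$.
   Context: Identify $\mathbb{R}^2$ with $\mathbb{C}$. Let $C$ be the unit circle centered at $0$. For $t\in\mathbb{R}$ put $z_k=e^{i(2\alpha k+t)}$, $k=1,\dots,N$ (indices modulo $N$); these are the vertices of a regular $N$-gon inscribed in $C$. For each $k$ let $w_k$ be the second intersection with $C$ of the line through $d$ and $z_k$, i.e. $w_k=\dfrac{d\bar z_k-1}{\bar z_k-d}$. The (convex, cyclic) polygon $P$ with consecutive vertices $w_1,\dots,w_N$ is the harmonic polygon associated with $d$ and $t$; for fixed $N,d$ the harmonic family is obtained by varying $t$. The internal angle $\theta_k\in(0,\pi)$ is $\angle w_{k-1}w_kw_{k+1}$. For $X=(X_1,\dots,X_N)$, $e_k(X)=\sum_{1\le i_1<\dots<i_k\le N}X_{i_1}\cdots X_{i_k}$ denotes the $k$-th elementary symmetric function. *)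

theory Defs
  imports "HOL-Analysis.Analysis"
begin

text \<open>Indices are integers; both \<^term>\<open>circle_vertex N t\<close> and \<^term>\<open>harmonic_vertex N d t\<close> are
  \<open>N\<close>-periodic in the index, which realises the convention ``indices modulo \<open>N\<close>''.\<close>

definition circle_vertex :: "nat \<Rightarrow> real \<Rightarrow> int \<Rightarrow> complex" where
  "circle_vertex N t k = (let \<alpha> = pi / real N in cis (2 * \<alpha> * of_int k + t))"

definition second_intersection :: "complex \<Rightarrow> complex \<Rightarrow> complex" where
  "second_intersection d z = (d * cnj z - 1) / (cnj z - d)"

definition harmonic_vertex :: "nat \<Rightarrow> real \<Rightarrow> real \<Rightarrow> int \<Rightarrow> complex" where
  "harmonic_vertex N d t k = second_intersection (of_real d) (circle_vertex N t k)"

text \<open>The unoriented angle at \<open>b\<close>, in \<open>[0, pi]\<close>. For consecutive vertices of a convex polygon this is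
  the internal angle.\<close>

definition vertex_angle :: "'a::real_inner \<Rightarrow> 'a \<Rightarrow> 'a \<Rightarrow> real" where
  "vertex_angle a b c = arccos (((a - b) \<bullet> (c - b)) / (norm (a - b) * norm (c - b)))"

definition harmonic_angle :: "nat \<Rightarrow> real \<Rightarrow> real \<Rightarrow> int \<Rightarrow> real" where
  "harmonic_angle N d t k =
     vertex_angle (harmonic_vertex N d t (k - 1)) (harmonic_vertex N d t k)
       (harmonic_vertex N d t (k + 1))"

definition elem_sym :: "nat \<Rightarrow> nat \<Rightarrow> (nat \<Rightarrow> 'a::comm_semiring_1) \<Rightarrow> 'a" where
  "elem_sym N j X = (\<Sum>S | S \<subseteq> {1..N} \<and> card S = j. \<Prod>i\<in>S. X i)"

lemma circle_vertex_periodic: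
  assumes "N > 0"
  shows "circle_vertex N t (k + int N) = circle_vertex N t k"
proof -
  have "2 * (pi / real N) * of_int (k + int N) + t = (2 * (pi / real N) * of_int k + t) + 2 * pi"
    using assms by (simp add: field_simps)
  then have "circle_vertex N t (k + int N) = cis ((2 * (pi / real N) * of_int k + t) + 2 * pi)"
    by (simp only: circle_vertex_def Let_def)
  then show ?thesis
    by (simp add: circle_vertex_def cis.ctr)
qed

text \<open>The formula in \<^term>\<open>second_intersection\<close> does give the second point in which the line
  through \<open>d\<close> and \<open>z\<close> meets the unit circle.\<close>

lemma second_intersection_on_circle:
  fixes d :: real and z :: complex
  assumes d: "\<bar>d\<bar> < 1" and z: "norm z = 1"
  shows "sphere 0 1 \<inter> affine hull {of_real d, z} = {z, second_intersection (of_real d) z}"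
    and "second_intersection (of_real d) z \<noteq> z"
proof -
  define u where "u = z - of_real d"
  define s0 where "s0 = - (1 - d\<^sup>2) / (norm u)\<^sup>2"
  have d2: "d\<^sup>2 < 1"
    using d by (simp add: abs_square_less_1)
  have u0: "u \<noteq> 0"
    using d z by (auto simp: u_def)
  have s0neg: "s0 < 0"
    using d2 u0 by (simp add: s0_def divide_neg_pos)
  have zu: "z = of_real d + u"
    by (simp add: u_def)
  have cu: "cnj z - of_real d = cnj u"
    by (simp add: u_def)
  have uu: "u * cnj u = of_real ((norm u)\<^sup>2)"
    using complex_norm_square by simp
  have W: "second_intersection (of_real d) z = of_real d + of_real s0 * u"
  proof -
    have "second_intersection (of_real d) z = (of_real d * cnj u - of_real (1 - d\<^sup>2)) / cnj u"
      unfolding second_intersection_def cu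
      by (simp add: u_def algebra_simps power2_eq_square)
    also have "\<dots> = of_real d - of_real (1 - d\<^sup>2) / cnj u"
      using u0 by (simp add: diff_divide_distrib)
    also have "of_real (1 - d\<^sup>2) / cnj u = of_real (1 - d\<^sup>2) * u / (u * cnj u)"
      using u0 by simp
    also have "\<dots> = - of_real s0 * u"
      unfolding uu s0_def by (simp add: diff_divide_distrib left_diff_distrib)
    finally show ?thesis by simp
  qed
  have nrm: "(norm (of_real d + of_real s * u))\<^sup>2 = d\<^sup>2 + 2 * s * d * Re u + s\<^sup>2 * (norm u)\<^sup>2" for s
    unfolding cmod_power2 by (simp add: algebra_simps power2_eq_square)
  have one: "1 = d\<^sup>2 + 2 * d * Re u + (norm u)\<^sup>2"
    using nrm[of 1] z zu by simp
  have on: "norm (of_real d + of_real s * u) = 1 \<longleftrightarrow> s = 1 \<or> s = s0" for s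
  proof -
    have "norm (of_real d + of_real s * u) = 1 \<longleftrightarrow> (norm (of_real d + of_real s * u))\<^sup>2 = 1"
      by (simp add: abs_square_eq_1)
    also have "(norm (of_real d + of_real s * u))\<^sup>2 - 1 = (s - 1) * (s * (norm u)\<^sup>2 + (1 - d\<^sup>2))"
    proof -
      have r: "2 * d * Re u = 1 - d\<^sup>2 - (norm u)\<^sup>2"
        using one by simp
      have "2 * s * d * Re u = s * (1 - d\<^sup>2 - (norm u)\<^sup>2)"
        using r by (metis mult.assoc mult.commute)
      then show ?thesis
        unfolding nrm by (simp add: algebra_simps power2_eq_square)
    qed
    then have "(norm (of_real d + of_real s * u))\<^sup>2 = 1
        \<longleftrightarrow> (s - 1) * (s * (norm u)\<^sup>2 + (1 - d\<^sup>2)) = 0"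
      by (metis diff_eq_eq add_0 right_minus_eq)
    also have "\<dots> \<longleftrightarrow> s = 1 \<or> s = s0"
    proof -
      have "s * (norm u)\<^sup>2 + (1 - d\<^sup>2) = 0 \<longleftrightarrow> s = s0"
        using u0 by (auto simp: s0_def field_simps)
      then show ?thesis by (simp only: mult_eq_0_iff right_minus_eq)
    qed
    finally show ?thesis .
  qed
  have hull: "p \<in> affine hull {of_real d, z} \<longleftrightarrow> (\<exists>s. p = of_real d + of_real s * u)" for p
  proof
    assume "p \<in> affine hull {of_real d, z}"
    then obtain a s where "p = a *\<^sub>R of_real d + s *\<^sub>R z" "a + s = 1"
      by (auto simp: affine_hull_2)
    then have "p = (1 - s) *\<^sub>R of_real d + s *\<^sub>R z"
      by (metis add_diff_cancel_right')
    then have "p = of_real d + of_real s * u"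
      by (simp add: u_def scaleR_conv_of_real algebra_simps)
    then show "\<exists>s. p = of_real d + of_real s * u" ..
  next
    assume "\<exists>s. p = of_real d + of_real s * u"
    then obtain s where s: "p = of_real d + of_real s * u" ..
    have "p = (1 - s) *\<^sub>R of_real d + s *\<^sub>R z"
      by (simp add: s u_def scaleR_conv_of_real algebra_simps)
    moreover have "(1 - s) + s = 1" by simp
    ultimately show "p \<in> affine hull {of_real d, z}"
      unfolding affine_hull_2 by blast
  qed
  show "sphere 0 1 \<inter> affine hull {of_real d, z} = {z, second_intersection (of_real d) z}"
  proof (intro equalityI subsetI)
    fix p assume "p \<in> sphere 0 1 \<inter> affine hull {of_real d, z}"
    then obtain s where s: "p = of_real d + of_real s * u" and "norm p = 1"
      using hull by auto
    then have "s = 1 \<or> s = s0" using on by simp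
    then show "p \<in> {z, second_intersection (of_real d) z}"
      using s zu W by auto
  next
    fix p assume "p \<in> {z, second_intersection (of_real d) z}"
    then obtain s where s: "p = of_real d + of_real s * u" "s = 1 \<or> s = s0"
      using zu W by (metis insert_iff mult_1 of_real_1 singletonD)
    then have "norm p = 1" "p \<in> affine hull {of_real d, z}"
      using on[of s] hull[of p] by blast+
    then show "p \<in> sphere 0 1 \<inter> affine hull {of_real d, z}"
      by simp
  qed
  show "second_intersection (of_real d) z \<noteq> z"
  proof
    assume "second_intersection (of_real d) z = z"
    then have "of_real s0 * u = 1 * u" using W zu by simp
    then have "s0 = 1" using u0 by (metis mult_right_cancel of_real_eq_1_iff)
    then show False using s0neg by simp
  qed
qed

end

theory Submission
  imports Defs "HOL-Computational_Algebra.Fundamental_Theorem_Algebra"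
begin

text \<open>The map from \<open>z\<^sub>k\<close> to \<open>w\<^sub>k\<close> is the disk automorphism \<open>(d - z) / (1 - d z)\<close>, which multiplies each
  difference by a product of two factors depending on one point each. Hence the ratio of consecutive
  edge vectors is explicit, and \<open>cot \<theta>\<^sub>k = A cos (2 \<alpha> k + t) + B\<close> with \<open>A\<close> and \<open>B\<close> independent of \<open>k\<close> and \<open>t\<close>. With
  \<open>y = (u + 1/u) / 2\<close> the factorisation of \<open>u\<^sup>N - c\<^sup>N\<close> shows that \<open>\<Prod>\<^sub>k (y + cos (2 \<alpha> k + t))\<close>
  depends on \<open>t\<close> only through a constant not involving \<open>y\<close>, so in the polynomial \<open>\<Prod>\<^sub>k (x + \<lambda>\<^sub>k)\<close>
  only the constant coefficient \<open>e\<^sub>N\<close> varies with \<open>t\<close>.\<close>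

section \<open>Products over roots of unity and over shifted cosines\<close>

lemma prod_diff_roots_unity:
  fixes x :: complex
  assumes "N > 0"
  shows "(\<Prod>k<N. x - cis (2 * pi * real k / real N)) = x ^ N - 1"
proof -
  define p :: "complex poly" where "p = monom 1 N + [:- 1:]"
  have val: "poly p y = y ^ N - 1" for y
    by (simp add: p_def poly_monom)
  have deg: "degree p = N"
    unfolding p_def using assms by (subst degree_add_eq_left) (auto simp: degree_monom_eq)
  then have lc: "lead_coeff p = 1"
    using assms by (simp add: p_def coeff_pCons split: nat.split)
  have "rsquarefree p"
    unfolding rsquarefree_roots
  proof safe
    fix a assume "poly p a = 0" "poly (pderiv p) a = 0"
    then have "a ^ N = 1" "a ^ (N - 1) = 0"
      using assms by (simp_all add: val) (simp_all add: p_def pderiv_add pderiv_pCons pderiv_monom poly_monom)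
    then show False
      using assms by (auto simp: power_0_left)
  qed
  then have "p = (\<Prod>z | z ^ N = 1. [:- z, 1:])"
    using complex_poly_decompose_rsquarefree[of p] lc by (simp add: val)
  then have "x ^ N - 1 = (\<Prod>z | z ^ N = 1. x - z)"
    unfolding val[symmetric] by (simp add: poly_prod)
  also have "\<dots> = (\<Prod>k<N. x - cis (2 * pi * real k / real N))"
    by (rule prod.reindex_bij_betw[OF Complex.bij_betw_roots_unity[OF assms], symmetric])
  finally show ?thesis ..
qed

lemma prod_diff_scaled_roots_unity:
  fixes x c :: complex
  assumes "N > 0"
  shows "(\<Prod>k=1..N. x - c * cis (2 * pi * real k / real N)) = x ^ N - c ^ N"
proof (cases "c = 0")
  case True
  then show ?thesis using assms by simp
next
  case False
  \<comment> \<open>The index runs over \<open>1..N\<close> here but over \<open>0..N-1\<close> in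
    the previous lemma. The shift costs one extra root of unity, absorbed into \<open>b\<close>
    without changing the \<open>N\<close>-th power.\<close>
  define b where "b = c * cis (2 * pi / real N)"
  have "cis (2 * pi / real N) ^ N = 1"
    using assms by (simp only: Complex.DeMoivre) simp
  then have b: "b \<noteq> 0" "b ^ N = c ^ N"
    using False by (auto simp: b_def power_mult_distrib)
  have "(\<Prod>k=1..N. x - c * cis (2 * pi * real k / real N))
      = (\<Prod>k<N. x - c * cis (2 * pi * real (Suc k) / real N))"
    by (rule prod.reindex_bij_witness[of _ Suc "\<lambda>k. k - 1"]) auto
  also have "\<dots> = (\<Prod>k<N. b * (x / b - cis (2 * pi * real k / real N)))"
  proof (rule prod.cong)
    fix k
    have "2 * pi * real (Suc k) / real N = 2 * pi / real N + 2 * pi * real k / real N"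
      by (simp add: add_divide_distrib algebra_simps)
    then show "x - c * cis (2 * pi * real (Suc k) / real N)
        = b * (x / b - cis (2 * pi * real k / real N))"
      using b(1) by (simp only: cis_mult[symmetric]) (simp add: b_def algebra_simps)
  qed simp
  also have "\<dots> = b ^ N * ((x / b) ^ N - 1)"
    using prod_diff_roots_unity[OF assms, of "x / b"] by (simp add: prod.distrib)
  also have "\<dots> = x ^ N - c ^ N"
    using b(1) by (simp add: right_diff_distrib b(2)[symmetric] power_divide)
  finally show ?thesis .
qed

text \<open>If \<open>u + 1/u = 2 * y\<close>, then
  \<open>2 * u * (y + cos p) = (u + cis p) * (u + cis (- p))\<close>, so the product over
  \<open>k\<close> becomes a product of two differences of \<open>N\<close>-th powers divided by
  \<open>(2 * u) ^ N\<close>. In it the shift survives only in a term free of \<open>u\<close>;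
  hence no \<open>y\<close> on the right-hand side.\<close>

lemma prod_add_cos_diff:
  fixes N :: nat and y t t' :: real
  assumes "N > 0"
  shows "(\<Prod>k=1..N. y + cos (2 * pi * real k / real N + t))
       - (\<Prod>k=1..N. y + cos (2 * pi * real k / real N + t'))
       = (- 1) ^ N * (cos (real N * t') - cos (real N * t)) / 2 ^ (N - 1)"
proof -
  define Y where "Y = complex_of_real y"
  \<comment> \<open>A solution of \<open>u + 1/u = 2 * Y\<close>, taken in the complex plane since
    it is not real when \<open>\<bar>y\<bar> < 1\<close>.\<close>
  define u where "u = Y + csqrt (Y\<^sup>2 - 1)"
  have "(u - Y)\<^sup>2 = Y\<^sup>2 - 1"
    by (simp add: u_def)
  then have uu: "u * u + 1 = 2 * Y * u"
    by (simp add: power2_diff power2_eq_square algebra_simps)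
  then have u0: "u \<noteq> 0"
    by auto
  have *: "complex_of_real (\<Prod>k=1..N. y + cos (2 * pi * real k / real N + s))
      = (u ^ N + 1 / u ^ N - 2 * (- 1) ^ N * complex_of_real (cos (real N * s))) / 2 ^ N" for s
  proof -
    let ?r = "\<lambda>k. 2 * pi * real k / real N"
    \<comment> \<open>Writing \<open>u + cnj z\<close> as the conjugate of \<open>cnj u + z\<close>
      makes both factors range over the same roots of unity, so one factorisation serves for
      both.\<close>
    have fact: "complex_of_real (y + cos (?r k + s))
        = (u - (- cis s) * cis (?r k)) * cnj (cnj u - (- cis s) * cis (?r k)) / (2 * u)" for k
    proof -
      define z where "z = cis (?r k + s)"
      have "z * cnj z = 1"
        by (simp add: z_def cis_cnj cis_mult)
      moreover have "z + cnj z = 2 * complex_of_real (cos (?r k + s))"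
        unfolding complex_add_cnj by (simp add: z_def)
      ultimately have "(u + z) * (u + cnj z) = 2 * u * complex_of_real (y + cos (?r k + s))"
        using uu by (simp add: Y_def) algebra
      moreover have "cis s * cis (?r k) = z"
        by (simp add: z_def cis_mult add.commute)
      ultimately show ?thesis
        using u0 by simp
    qed
    have "complex_of_real (\<Prod>k=1..N. y + cos (?r k + s))
        = (u ^ N - (- cis s) ^ N) * cnj (cnj u ^ N - (- cis s) ^ N) / (2 * u) ^ N"
      unfolding of_real_prod fact prod_dividef prod.distrib cnj_prod[symmetric]
        prod_diff_scaled_roots_unity[OF assms] by simp
    also have "\<dots> = (u ^ N + 1 / u ^ N - 2 * (- 1) ^ N * complex_of_real (cos (real N * s))) / 2 ^ N"
    proof -
      define e :: complex where "e = (- 1) ^ N"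
      define c where "c = cis (real N * s)"
      have e: "e * e = 1"
        by (simp add: e_def flip: power_mult_distrib)
      have c: "(- cis s) ^ N = e * c" 
        unfolding e_def c_def by (subst power_minus) (simp add: Complex.DeMoivre)
      have ce: "cnj e = e"
        by (simp add: e_def)
      have c1: "c * cnj c = 1"
        by (simp add: c_def cis_cnj cis_mult)
      have c2: "c + cnj c = 2 * complex_of_real (cos (real N * s))"
        unfolding complex_add_cnj by (simp add: c_def)
      have "(P - e * c) * (P - e * cnj c) = P * P + e * e * (c * cnj c) - e * (c + cnj c) * P" for P
        by (simp add: algebra_simps)
      then have "(u ^ N - (- cis s) ^ N) * cnj (cnj u ^ N - (- cis s) ^ N)
          = u ^ N * u ^ N + 1 - 2 * e * complex_of_real (cos (real N * s)) * u ^ N"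
        unfolding c by (simp add: e c1 c2 ce)
      then show ?thesis
        using u0 by (simp add: power_mult_distrib add_divide_distrib diff_divide_distrib flip: e_def)
    qed
    finally show ?thesis .
  qed
  \<comment> \<open>As \<open>u\<close> depends on \<open>y\<close> alone,
    \<open>u ^ N + 1 / u ^ N\<close> cancels; the factor 2 before the cosine turns
    \<open>2 ^ N\<close> into \<open>2 ^ (N - 1)\<close>.\<close>
  have "complex_of_real ((\<Prod>k=1..N. y + cos (2 * pi * real k / real N + t))
       - (\<Prod>k=1..N. y + cos (2 * pi * real k / real N + t')))
      = complex_of_real ((- 1) ^ N * (cos (real N * t') - cos (real N * t)) / 2 ^ (N - 1))"
    using assms unfolding of_real_diff *
    by (cases N) (simp_all add: add_divide_distrib diff_divide_distrib right_diff_distrib)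
  then show ?thesis
    by (simp only: of_real_eq_iff)
qed

section \<open>Elementary symmetric functions as polynomial coefficients\<close>

lemma prod_add_eq_sum_elem_sym:
  fixes X :: "nat \<Rightarrow> 'a::comm_semiring_1"
  shows "(\<Prod>k=1..N. x + X k) = (\<Sum>j\<le>N. elem_sym N (N - j) X * x ^ j)"
proof -
  have "(\<Prod>k=1..N. x + X k) = (\<Prod>k=1..N. X k + x)"
    by (simp add: add.commute)
  also have "\<dots> = (\<Sum>S\<in>Pow {1..N}. prod X S * x ^ (N - card S))"
    by (subst prod_add) (auto intro!: sum.cong simp: card_Diff_subset finite_subset)
  also have "\<dots> = (\<Sum>i\<le>N. \<Sum>S | S \<in> Pow {1..N} \<and> card S = i. prod X S * x ^ (N - card S))"
    by (rule sum.group[symmetric]) (use card_mono[of "{1..N}"] in auto)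
  also have "\<dots> = (\<Sum>i\<le>N. elem_sym N i X * x ^ (N - i))"
    by (simp add: elem_sym_def sum_distrib_right)
  also have "\<dots> = (\<Sum>j\<le>N. elem_sym N (N - j) X * x ^ j)"
    by (rule sum.reindex_bij_witness[of _ "\<lambda>j. N - j" "\<lambda>j. N - j"]) auto
  finally show ?thesis .
qed

text \<open>Two real polynomials differing by a constant agree in all coefficients of positive
  degree, and \<open>elem_sym N j\<close> is the coefficient of degree
  \<open>N - j > 0\<close>.\<close>

lemma elem_sym_eq_if_prod_diff_const:
  fixes X Y :: "nat \<Rightarrow> real"
  assumes "\<And>x. (\<Prod>k=1..N. x + X k) - (\<Prod>k=1..N. x + Y k) = C" and "j < N"
  shows "elem_sym N j X = elem_sym N j Y"
proof -
  define c where "c i = elem_sym N (N - i) X - elem_sym N (N - i) Y" for i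
  have "\<forall>x. (\<Sum>i\<le>N. c i * x ^ i) = C"
    using assms(1) unfolding prod_add_eq_sum_elem_sym c_def
    by (simp add: left_diff_distrib sum_subtractf)
  then have "c (N - j) = 0"
    using assms(2) by (simp add: polyfun_eq_const)
  then show ?thesis
    using assms(2) by (simp add: c_def)
qed

section \<open>Cotangents of the internal angles\<close>

lemma cot_vertex_angle:
  fixes a b c :: complex
  assumes "Im ((a - b) / (c - b)) > 0"
  shows "cot (vertex_angle a b c) = Re ((a - b) / (c - b)) / Im ((a - b) / (c - b))"
proof -
  \<comment> \<open>The argument of \<open>w\<close> is the oriented angle at \<open>b\<close>. A
    positive imaginary part puts it in \<open>(0, pi)\<close>, where it equals the unoriented angle,
    with cosine \<open>x\<close>.\<close>
  define w where "w = (a - b) / (c - b)"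
  define x where "x = Re w / norm w"
  have cb: "c - b \<noteq> 0" and w0: "norm w > 0" and im: "Im w > 0"
    using assms by (auto simp: w_def)
  have ab: "a - b = w * (c - b)"
    using cb by (simp add: w_def)
  have "(a - b) \<bullet> (c - b) = Re w * (norm (c - b))\<^sup>2"
    unfolding ab inner_complex_def cmod_power2 by (simp add: algebra_simps power2_eq_square)
  then have "vertex_angle a b c = arccos x"
    using cb unfolding vertex_angle_def x_def
    by (simp add: ab norm_mult power2_eq_square)
  moreover have "\<bar>x\<bar> \<le> 1"
    using w0 abs_Re_le_cmod[of w] by (simp add: x_def)
  moreover have "sqrt (1 - x\<^sup>2) = Im w / norm w"
  proof (rule real_sqrt_unique)
    show "(Im w / norm w)\<^sup>2 = 1 - x\<^sup>2"
    proof -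
      have "(Im w)\<^sup>2 = (norm w)\<^sup>2 - (Re w)\<^sup>2"
        using cmod_power2[of w] by simp
      then show ?thesis
        using w0 by (simp add: x_def power_divide diff_divide_distrib)
    qed
  qed (use im in simp)
  ultimately have "cot (vertex_angle a b c) = x / (Im w / norm w)"
    by (simp add: cot_def sin_arccos abs_le_iff)
  then show ?thesis
    using w0 by (simp add: x_def w_def)
qed

text \<open>A Moebius map sends \<open>x - y\<close> to a constant times \<open>x - y\<close> times
  one factor for each point. In the ratio the constant and the factor of the common point
  \<open>z\<close> cancel.\<close>

lemma second_intersection_diff_ratio:
  fixes d :: real and z q :: complex
  assumes d: "\<bar>d\<bar> < 1" and z: "norm z = 1" and q: "norm q = 1" "q \<noteq> 1"
  shows "(second_intersection d (z / q) - second_intersection d z)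
       / (second_intersection d (z * q) - second_intersection d z)
       = (d * z * q - 1) / (q - d * z)"
proof -
  have nz: "1 - of_real d * y \<noteq> 0" if "norm y = 1" for y :: complex
  proof
    assume "1 - of_real d * y = 0"
    then have "norm (of_real d * y) = 1"
      by (metis norm_one right_minus_eq)
    then show False
      using d that by (simp add: norm_mult)
  qed
  \<comment> \<open>On the unit circle \<open>cnj y = 1/y\<close>, so expanding the fraction by
    \<open>y\<close> removes the conjugate.\<close>
  have si: "second_intersection d y = (d - y) / (1 - d * y)" if "norm y = 1" for y :: complex
  proof -
    have "y * cnj y = 1"
      by (simp add: that flip: complex_norm_square)
    then have "y \<noteq> 0" "y * (d * cnj y - 1) = d - y" "y * (cnj y - d) = 1 - d * y"
      by (auto simp: algebra_simps)
    then show ?thesis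
      unfolding second_intersection_def by (metis mult_divide_mult_cancel_left)
  qed
  have diff: "second_intersection d x - second_intersection d y
      = (d\<^sup>2 - 1) * (x - y) / ((1 - d * x) * (1 - d * y))" if "norm x = 1" "norm y = 1" for x y :: complex
    unfolding si[OF that(1)] si[OF that(2)] using nz[OF that(1)] nz[OF that(2)]
    by (simp add: divide_simps) (simp add: algebra_simps power2_eq_square)
  have n: "norm (z / q) = 1" "norm (z * q) = 1" "z \<noteq> 0" "q \<noteq> 0"
    using z q by (auto simp: norm_divide norm_mult)
  have "d\<^sup>2 \<noteq> 1"
    using d by (simp add: abs_square_eq_1)
  then have d1: "complex_of_real d * complex_of_real d - 1 \<noteq> 0"
    by (metis eq_iff_diff_eq_0 of_real_1 of_real_eq_iff of_real_mult power2_eq_square)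
  have qd: "q - d * z \<noteq> 0"
    using nz[OF n(1)] n(4) by (simp add: field_simps)
  have "(second_intersection d (z / q) - second_intersection d z)
       / (second_intersection d (z * q) - second_intersection d z)
      = (z / q - z) / (z * q - z) * ((1 - d * (z * q)) / (1 - d * (z / q)))"
    unfolding diff[OF n(1) z] diff[OF n(2) z]
    using d1 nz[OF z] nz[OF n(1)] nz[OF n(2)] by (simp add: power2_eq_square)
  also have "(z / q - z) / (z * q - z) = - 1 / q"
    using n(3,4) q(2) by (simp add: divide_simps algebra_simps)
  also have "- 1 / q * ((1 - d * (z * q)) / (1 - d * (z / q))) = (d * z * q - 1) / (q - d * z)"
    using n(4) qd nz[OF n(1)] by (simp add: divide_simps algebra_simps)
  finally show ?thesis .
qed

text \<open>The cotangent is \<open>Re w / Im w\<close> for the ratio \<open>w\<close> of edge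
  vectors. Once the denominator of \<open>w\<close> is made real it cancels, leaving an imaginary
  part independent of \<open>k\<close> and \<open>t\<close> and a real part affine in the
  cosine.\<close>

lemma cot_harmonic_angle:
  fixes N :: nat and d t :: real
  assumes N: "N \<ge> 3" and d: "\<bar>d\<bar> < 1"
  defines "a \<equiv> 2 * pi / real N"
  shows "cot (harmonic_angle N d t k)
       = (2 * d * cos (a * of_int k + t) - (1 + d\<^sup>2) * cos a) / ((1 - d\<^sup>2) * sin a)"
proof -
  define f where "f = a * of_int k + t"
  define q where "q = cis a"
  define z where "z = cis f"
  \<comment> \<open>The strict bound \<open>a < pi\<close> comes from \<open>N \<ge> 3\<close>; with
    \<open>\<bar>d\<bar> < 1\<close> it fixes the orientation \<open>Im w > 0\<close>.\<close>
  have "a > 0" "a < pi"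
    using N pi_gt_zero by (auto simp: a_def field_simps)
  then have sa: "sin a > 0"
    by (rule sin_gt_zero)
  then have q1: "q \<noteq> 1"
    by (auto simp: q_def complex_eq_iff)
  have d2: "1 - d\<^sup>2 > 0"
    using d by (simp add: abs_square_less_1)
  have cv: "circle_vertex N t k = z" "circle_vertex N t (k - 1) = z / q"
      "circle_vertex N t (k + 1) = z * q"
    by (simp_all add: circle_vertex_def z_def q_def f_def a_def cis_divide cis_mult algebra_simps)
  define w where "w = (harmonic_vertex N d t (k - 1) - harmonic_vertex N d t k)
       / (harmonic_vertex N d t (k + 1) - harmonic_vertex N d t k)"
  define m where "m = q - d * z"
  have w: "w = (d * z * q - 1) / m"
    unfolding w_def harmonic_vertex_def cv m_def
    by (rule second_intersection_diff_ratio[OF d]) (use q1 in \<open>auto simp: z_def q_def\<close>)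
  have m0: "m \<noteq> 0"
  proof
    assume "m = 0"
    then have "norm q = norm (d * z)"
      by (simp add: m_def)
    then show False
      using d by (simp add: q_def z_def norm_mult)
  qed
  then have m2: "(norm m)\<^sup>2 > 0" by simp
  \<comment> \<open>\<open>z\<close> enters the expanded product only through the real number
    \<open>z + cnj z\<close>, hence not the imaginary part.\<close>
  have num: "(d * z * q - 1) * cnj m
      = Complex (2 * d * cos f - (1 + d\<^sup>2) * cos a) ((1 - d\<^sup>2) * sin a)"
  proof -
    have "z * cnj z = 1" "q * cnj q = 1"
      by (simp_all add: z_def q_def cis_cnj cis_mult)
    then have "(d * z * q - 1) * cnj m = d * (z + cnj z) - cnj q - of_real (d\<^sup>2) * q"
      unfolding m_def by (simp add: power2_eq_square) algebra
    then show ?thesis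
      by (simp add: complex_eq_iff z_def q_def algebra_simps)
  qed
  have "w = Complex (2 * d * cos f - (1 + d\<^sup>2) * cos a) ((1 - d\<^sup>2) * sin a) / of_real ((norm m)\<^sup>2)"
    unfolding w num[symmetric] using m0 complex_norm_square[of m] by (simp add: field_simps)
  then have re: "Re w = (2 * d * cos f - (1 + d\<^sup>2) * cos a) / (norm m)\<^sup>2"
    and im: "Im w = (1 - d\<^sup>2) * sin a / (norm m)\<^sup>2"
    by (simp_all only: Re_divide_of_real Im_divide_of_real complex.sel)
  have "Im w > 0"
    unfolding im using m2 d2 sa by simp
  from cot_vertex_angle[OF this[unfolded w_def]]
  have "cot (harmonic_angle N d t k) = Re w / Im w"
    by (simp only: harmonic_angle_def w_def)
  then show ?thesis
    unfolding re im using m2 by (simp add: f_def)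
qed

section \<open>Invariance over the family\<close>

theorem theorem1:
  fixes N :: nat and d :: real
  assumes "N \<ge> 3" and "\<bar>d\<bar> < 1"
  shows "\<forall>j\<in>{1..N - 1}. \<forall>t t' :: real.
           elem_sym N j (\<lambda>k. cot (harmonic_angle N d t (int k)))
         = elem_sym N j (\<lambda>k. cot (harmonic_angle N d t' (int k)))"
proof (intro ballI allI)
  fix j and t t' :: real
  assume j: "j \<in> {1..N - 1}"
  define D where "D = (1 - d\<^sup>2) * sin (2 * pi / real N)"
  define A where "A = 2 * d / D"
  define B where "B = - ((1 + d\<^sup>2) * cos (2 * pi / real N) / D)"
  have cot: "cot (harmonic_angle N d s (int k)) = B + A * cos (2 * pi * real k / real N + s)" for s k
    unfolding cot_harmonic_angle[OF assms] A_def B_def D_def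
    by (simp add: diff_divide_distrib)
  show "elem_sym N j (\<lambda>k. cot (harmonic_angle N d t (int k)))
      = elem_sym N j (\<lambda>k. cot (harmonic_angle N d t' (int k)))"
  \<comment> \<open>This is the case \<open>d = 0\<close> of a regular polygon: every cotangent
    equals \<open>B\<close>, and dividing by \<open>A\<close> below would be impossible.\<close>
  proof (cases "A = 0")
    case True
    then show ?thesis by (simp add: cot)
  next
    case False
    have scale: "(\<Prod>k=1..N. x + (B + A * cos (2 * pi * real k / real N + s)))
        = A ^ N * (\<Prod>k=1..N. (x + B) / A + cos (2 * pi * real k / real N + s))" for x s
    proof -
      have "(\<Prod>k=1..N. x + (B + A * cos (2 * pi * real k / real N + s)))
          = (\<Prod>k=1..N. A * ((x + B) / A + cos (2 * pi * real k / real N + s)))"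
        using False by (intro prod.cong) (auto simp: field_simps)
      then show ?thesis by (simp add: prod.distrib)
    qed
    have "N > 0" "j < N"
      using assms(1) j by auto
    \<comment> \<open>The constant of \<open>elem_sym_eq_if_prod_diff_const\<close> is found by
      unification: \<open>A ^ N\<close> times the right-hand side of
      \<open>prod_add_cos_diff\<close>, from which \<open>x\<close> has disappeared.\<close>
    then show ?thesis
      unfolding cot
      by (intro elem_sym_eq_if_prod_diff_const)
        (simp_all only: scale right_diff_distrib[symmetric] prod_add_cos_diff)
  qed
qed

end
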